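(* Let $n\ge 2$ and $0\le m\le \binom{n}{2}$ be integers, and let $r$ be a positive integer such that $\binom{r}{2}<m\le\binom{r+1}{2}$. Then \[ D(n,0,m)=n-r. \]
   Context: All graphs are finite and simple. For a vertex $u$ of a graph $G$, $N[u]$ is its closed neighborhood (the set consisting of $u$ and all vertices adjacent to $u$). A set $S\subseteq V(G)$ is dominating if every vertex of $G$ lies in $N[s]$ for some $s\in S$. A vertex $u\in V(G)$ is overdominated by $S$ if $|N[u]\cap S|\ge 2$. The cardinality-redundance $CR(S)$ is the number of vertices of $G$ overdominated by $S$, and $CR(G)$ is the minimum of $CR(S)$ over all dominating sets $S$ of $G$. $\gamma_{CR}(G)$ is the minimum size of a dominating set $S$ with $CR(S)=CR(G)$. For integers $n\ge 1$, $0\le k\le n$ and $0\le m\le\binom n2$, $D(n,k,m)$ is the maximum of $\gamma_{CR}(G)$ over all graphs $G$ with $n$ vertices, $m$ edges and $CR(G)=k$; if no such graph exists, $D(n,k,m)=0$. *)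

theory Defs
  imports Main
begin

definition simple_graph :: "'a set \<Rightarrow> 'a set set \<Rightarrow> bool" where
  "simple_graph V E \<longleftrightarrow> finite V \<and> (\<forall>e\<in>E. e \<subseteq> V \<and> card e = 2)"

definition closed_nbhd :: "'a set set \<Rightarrow> 'a \<Rightarrow> 'a set" where
  "closed_nbhd E u = insert u {v. {u, v} \<in> E}"

definition dominating :: "'a set \<Rightarrow> 'a set set \<Rightarrow> 'a set \<Rightarrow> bool" where
  "dominating V E S \<longleftrightarrow> S \<subseteq> V \<and> (\<forall>v\<in>V. \<exists>s\<in>S. v \<in> closed_nbhd E s)"

definition overdominated :: "'a set set \<Rightarrow> 'a set \<Rightarrow> 'a \<Rightarrow> bool" where
  "overdominated E S u \<longleftrightarrow> card (closed_nbhd E u \<inter> S) \<ge> 2"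

definition CR_of_set :: "'a set \<Rightarrow> 'a set set \<Rightarrow> 'a set \<Rightarrow> nat" where
  "CR_of_set V E S = card {u \<in> V. overdominated E S u}"

(* The minima below are taken over finite nonempty sets whenever V is finite:
   V dominates itself, and dominating sets are subsets of V. *)

definition CR :: "'a set \<Rightarrow> 'a set set \<Rightarrow> nat" where
  "CR V E = Min {CR_of_set V E S | S. dominating V E S}"

definition gamma_CR :: "'a set \<Rightarrow> 'a set set \<Rightarrow> nat" where
  "gamma_CR V E = Min {card S | S. dominating V E S \<and> CR_of_set V E S = CR V E}"

(* Every finite graph is isomorphic to one whose vertices are natural numbers, and
   gamma_CR is an isomorphism invariant, so ranging over V :: nat set loses nothing.
   The values are bounded by n, so Max is applied to a finite set. *)

definition gamma_CR_values :: "nat \<Rightarrow> nat \<Rightarrow> nat \<Rightarrow> nat set" where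
  "gamma_CR_values n k m =
    {gamma_CR V E | (V :: nat set) E.
       simple_graph V E \<and> card V = n \<and> card E = m \<and> CR V E = k}"

definition D :: "nat \<Rightarrow> nat \<Rightarrow> nat \<Rightarrow> nat" where
  "D n k m = (if gamma_CR_values n k m = {} then 0 else Max (gamma_CR_values n k m))"

end

theory Submission imports Defs
begin

text \<open>
  A graph has cardinality-redundance 0 exactly when it has a dominating set \<open>S\<close> that overdominates
  no vertex (an efficient dominating set). Such an \<open>S\<close> is independent, and every vertex outside
  \<open>S\<close> has exactly one neighbour in \<open>S\<close>. With \<open>q = n - card S\<close> vertices outside \<open>S\<close> there are
  therefore at most \<open>(q choose 2) + q = (q + 1) choose 2\<close> edges: those between two outside
  vertices, and one from each outside vertex to \<open>S\<close>
  (lemma \<open>card_edges_le_of_efficient\<close>). If there are more than \<open>r choose 2\<close> edges, then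
  \<open>r \<le> q\<close>, and so \<open>card S \<le> n - r\<close>.

  Equality holds for the disjoint union of \<open>n - r - 1\<close> isolated vertices and a graph with \<open>m\<close> edges
  on \<open>r + 1\<close> vertices that has a vertex adjacent to all the others
  (lemma \<open>ex_graph_gamma_CR_ge\<close>). That vertex together with the isolated ones is efficient, and
  every dominating set contains all isolated vertices and at least one more vertex.
\<close>

section \<open>Dominating sets attaining the cardinality-redundance\<close>

lemma finite_dominating_image:
  assumes "finite V"
  shows "finite {f S | S. dominating V E S \<and> P S}"
proof -
  have "{f S | S. dominating V E S \<and> P S} \<subseteq> f ` Pow V"
    by (auto simp: dominating_def)
  then show ?thesis
    using assms by (meson finite_Pow_iff finite_imageI finite_subset)
qed

lemma dominating_self: "dominating V E V"
  by (auto simp: dominating_def closed_nbhd_def)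

lemma CR_attained:
  assumes "finite V"
  obtains S where "dominating V E S" "CR_of_set V E S = CR V E"
proof -
  have "finite {CR_of_set V E S | S. dominating V E S}"
    using finite_dominating_image[OF assms, where P = "\<lambda>_. True"] by simp
  moreover have "{CR_of_set V E S | S. dominating V E S} \<noteq> {}"
    using dominating_self by blast
  ultimately have "CR V E \<in> {CR_of_set V E S | S. dominating V E S}"
    unfolding CR_def by (rule Min_in)
  then show thesis
    using that by auto
qed

lemma CR_eq_0I:
  assumes "finite V" "dominating V E S" "CR_of_set V E S = 0"
  shows "CR V E = 0"
proof -
  have "finite {CR_of_set V E S | S. dominating V E S}"
    using finite_dominating_image[OF assms(1), where P = "\<lambda>_. True"] by simp
  then have "CR V E \<le> CR_of_set V E S"
    unfolding CR_def using assms(2) by (intro Min_le) auto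
  then show ?thesis
    using assms(3) by simp
qed

lemma gamma_CR_attained:
  assumes "finite V"
  obtains S where "dominating V E S" "CR_of_set V E S = CR V E" "card S = gamma_CR V E"
proof -
  let ?A = "{card S | S. dominating V E S \<and> CR_of_set V E S = CR V E}"
  have "?A \<noteq> {}"
    using CR_attained[OF assms] by blast
  then have "gamma_CR V E \<in> ?A"
    unfolding gamma_CR_def using finite_dominating_image[OF assms] by (intro Min_in)
  then show thesis
    using that by auto
qed

section \<open>Counting edges outside an efficient dominating set\<close>

lemma not_overdominated_unique:
  assumes "finite S" "\<not> overdominated E S u"
    and "v \<in> closed_nbhd E u" "v \<in> S" "w \<in> closed_nbhd E u" "w \<in> S"
  shows "v = w"
proof (rule ccontr)
  assume "v \<noteq> w"
  then have "card {v, w} = 2"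
    by simp
  moreover have "card {v, w} \<le> card (closed_nbhd E u \<inter> S)"
    using assms by (intro card_mono) auto
  ultimately show False
    using assms(2) by (simp add: overdominated_def)
qed

lemma choose_two_plus_self: "(q choose 2) + q = (q + 1) choose 2"
  by (simp add: numeral_2_eq_2)

lemma card_edges_le_of_efficient:
  assumes G: "simple_graph V E" and dom: "dominating V E S"
    and eff: "CR_of_set V E S = 0"
  shows "card E \<le> (card V - card S + 1) choose 2"
proof -
  have finV: "finite V" and E: "\<And>e. e \<in> E \<Longrightarrow> e \<subseteq> V \<and> card e = 2"
    using G by (auto simp: simple_graph_def)
  have SV: "S \<subseteq> V"
    using dom by (simp add: dominating_def)
  then have finS: "finite S"
    using finV finite_subset by blast
  have no: "\<not> overdominated E S u" if "u \<in> V" for u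
    using eff finV that by (auto simp: CR_of_set_def)
  define R where "R = V - S"
  have finR: "finite R" and cardR: "card R = card V - card S"
    using finV finS SV by (auto simp: R_def card_Diff_subset)
  have "\<forall>u\<in>R. \<exists>s\<in>S. s \<in> closed_nbhd E u"
    using dom by (fastforce simp: R_def dominating_def closed_nbhd_def insert_commute)
  then obtain f where f: "\<And>u. u \<in> R \<Longrightarrow> f u \<in> S \<and> f u \<in> closed_nbhd E u"
    by metis
  define P where "P = {e. e \<subseteq> R \<and> card e = 2}"
  have "E \<subseteq> P \<union> (\<lambda>u. {u, f u}) ` R"
  proof
    fix e assume e: "e \<in> E"
    then obtain u v where uv: "e = {u, v}" "u \<noteq> v"
      using E by (meson card_2_iff)
    have V: "u \<in> V" "v \<in> V"
      using E[OF e] uv by auto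
    have nb: "v \<in> closed_nbhd E u" "u \<in> closed_nbhd E v"
        "u \<in> closed_nbhd E u" "v \<in> closed_nbhd E v"
      using e uv by (auto simp: closed_nbhd_def insert_commute)
    consider "u \<in> S" "v \<in> S" | "u \<in> R" "v \<in> S" | "u \<in> S" "v \<in> R" | "u \<in> R" "v \<in> R"
      using V by (auto simp: R_def)
    then show "e \<in> P \<union> (\<lambda>u. {u, f u}) ` R"
    proof cases
      case 1
      then show ?thesis
        using not_overdominated_unique[OF finS no] V nb uv by blast
    next
      case 2
      then have "f u = v"
        using not_overdominated_unique[OF finS no] V nb f by blast
      then show ?thesis
        using 2 uv by auto
    next
      case 3
      then have "f v = u"
        using not_overdominated_unique[OF finS no] V nb f by blast
      then show ?thesis
        using 3 uv by (auto simp: insert_commute)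
    next
      case 4
      then show ?thesis
        using uv by (auto simp: P_def)
    qed
  qed
  moreover have "finite P"
    using finR by (simp add: P_def)
  ultimately have "card E \<le> card (P \<union> (\<lambda>u. {u, f u}) ` R)"
    using finR by (intro card_mono) auto
  also have "\<dots> \<le> card P + card ((\<lambda>u. {u, f u}) ` R)"
    by (rule card_Un_le)
  also have "\<dots> \<le> (card R choose 2) + card R"
    using n_subsets[OF finR, of 2] card_image_le[OF finR] by (simp add: P_def)
  finally show ?thesis
    by (simp only: cardR choose_two_plus_self)
qed

lemma gamma_CR_le:
  assumes "simple_graph V E" "CR V E = 0" "r choose 2 < card E"
  shows "gamma_CR V E \<le> card V - r"
proof -
  have finV: "finite V"
    using assms(1) by (simp add: simple_graph_def)
  obtain S where S: "dominating V E S" "CR_of_set V E S = CR V E" "card S = gamma_CR V E"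
    using gamma_CR_attained[OF finV] .
  have le: "card S \<le> card V"
    using S(1) finV by (auto simp: dominating_def intro: card_mono)
  have "card E \<le> (card V - card S + 1) choose 2"
    using card_edges_le_of_efficient[OF assms(1) S(1)] S(2) assms(2) by simp
  then have "\<not> card V - card S + 1 \<le> r"
    using assms(3) binomial_right_mono[of "card V - card S + 1" r 2] by linarith
  then show ?thesis
    using le S(3) by linarith
qed

section \<open>The extremal graph\<close>

lemma ex_graph_gamma_CR_ge:
  fixes n m r :: nat
  assumes "r < n" "r \<le> m" "m \<le> (r + 1) choose 2"
  obtains V :: "nat set" and E where "simple_graph V E" "card V = n" "card E = m"
    "CR V E = 0" "n - r \<le> gamma_CR V E"
proof -
  define P where "P = {e. e \<subseteq> {1..r} \<and> card e = 2}"
  have finP: "finite P" and "card P = r choose 2"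
    using n_subsets[of "{1..r}" 2] by (auto simp: P_def)
  then have "m - r \<le> card P"
    using assms(3) choose_two_plus_self[of r] by simp
  then obtain F where F: "F \<subseteq> P" "card F = m - r"
    by (meson obtain_subset_with_card_n)
  \<comment> \<open>Vertex 0 is adjacent to all of \<open>{1..r}\<close>, and the vertices beyond \<open>r\<close> are isolated.\<close>
  define V where "V = {..<n}"
  define H where "H = (\<lambda>v. {0, v}) ` {1..r}"
  define E where "E = F \<union> H"
  have H: "e \<in> H \<Longrightarrow> 0 \<in> e" for e
    by (auto simp: H_def)
  have FR: "e \<in> F \<Longrightarrow> e \<subseteq> {1..r} \<and> card e = 2" for e
    using F by (auto simp: P_def)
  have "card H = r"
    unfolding H_def by (subst card_image) (auto simp: inj_on_def doubleton_eq_iff)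
  moreover have "F \<inter> H = {}"
    using H FR by fastforce
  moreover have "finite F" "finite H"
    using F finP finite_subset by (auto simp: H_def)
  ultimately have cardE: "card E = m"
    using F assms(2) by (simp add: E_def card_Un_disjoint)
  have ER: "e \<subseteq> {..r} \<and> card e = 2" if "e \<in> E" for e
    using that FR by (fastforce simp: E_def H_def)
  then have G: "simple_graph V E"
    using assms(1) by (fastforce simp: simple_graph_def V_def)
  define I where "I = {r<..<n}"
  have cardI: "card I = n - r - 1"
    by (simp add: I_def)
  have nbI: "closed_nbhd E v \<inter> I = {v} \<inter> I" for v
    using ER by (fastforce simp: closed_nbhd_def I_def)
  define S where "S = insert 0 I"
  have nb0: "0 \<in> closed_nbhd E v \<longleftrightarrow> v \<le> r" for v
  proof
    show "0 \<in> closed_nbhd E v \<Longrightarrow> v \<le> r"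
      using ER by (auto simp: closed_nbhd_def)
    show "v \<le> r \<Longrightarrow> 0 \<in> closed_nbhd E v"
      by (cases "v = 0") (auto simp: closed_nbhd_def E_def H_def insert_commute)
  qed
  have nbS: "closed_nbhd E v \<inter> S = (if v \<le> r then {0} else {v})" if "v \<in> V" for v
    using nbI[of v] nb0[of v] that by (auto simp: S_def I_def V_def)
  have "dominating V E S"
    unfolding dominating_def
  proof (intro conjI ballI)
    show "S \<subseteq> V"
      using assms(1) by (auto simp: S_def I_def V_def)
    fix v assume "v \<in> V"
    then obtain s where "s \<in> S" "s \<in> closed_nbhd E v"
      using nbS[of v] by (metis IntE all_not_in_conv insert_not_empty)
    then show "\<exists>s\<in>S. v \<in> closed_nbhd E s"
      by (auto simp: closed_nbhd_def insert_commute)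
  qed
  moreover have "CR_of_set V E S = 0"
    using nbS by (auto simp: CR_of_set_def overdominated_def V_def)
  ultimately have CR0: "CR V E = 0"
    using CR_eq_0I G by (auto simp: simple_graph_def)
  have finV: "finite V"
    by (simp add: V_def)
  obtain T where T: "dominating V E T" "card T = gamma_CR V E"
    using gamma_CR_attained[OF finV] by metis
  have "I \<subseteq> T"
  proof
    fix v assume v: "v \<in> I"
    then obtain s where "s \<in> T" "v \<in> closed_nbhd E s"
      using T(1) by (auto simp: dominating_def V_def I_def)
    then show "v \<in> T"
      using nbI[of s] v by auto
  qed
  moreover obtain t where "t \<in> T" "t \<le> r"
    using T(1) assms(1) nb0 by (fastforce simp: dominating_def V_def)
  ultimately have "insert t I \<subseteq> T" "t \<notin> I"
    by (auto simp: I_def)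
  moreover have "finite T"
    using T(1) finV finite_subset by (auto simp: dominating_def)
  ultimately have "n - r - 1 + 1 \<le> card T"
    using card_mono[of T "insert t I"] cardI by (simp add: I_def)
  then have "n - r \<le> gamma_CR V E"
    using T(2) by simp
  then show thesis
    using that G cardE CR0 by (simp add: V_def)
qed

section \<open>The extremal value\<close>

theorem theorem3p5:
  fixes n m r :: nat
  assumes "n \<ge> 2" and "m \<le> n choose 2"
    and "r > 0" and "r choose 2 < m" and "m \<le> (r + 1) choose 2"
  shows "int (D n 0 m) = int n - int r"
proof -
  have rn: "r < n"
    using assms(2,4) binomial_right_mono[of n r 2] by linarith
  \<comment> \<open>There are enough edges to join one vertex to \<open>r\<close> others, as
    \<open>(r - 1) * (r - 2) \<ge> 0\<close> gives \<open>r \<le> (r choose 2) + 1\<close>.\<close>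
  have "r \<le> (r choose 2) + 1"
  proof (induction r)
    case (Suc k)
    then show ?case
      using choose_two_plus_self[of k] by (cases k) auto
  qed simp
  then have rm: "r \<le> m"
    using assms(4) by linarith
  have le: "x \<le> n - r" if "x \<in> gamma_CR_values n 0 m" for x
    using that gamma_CR_le assms(4) unfolding gamma_CR_values_def by blast
  obtain V :: "nat set" and E where "simple_graph V E" "card V = n" "card E = m"
    "CR V E = 0" "n - r \<le> gamma_CR V E"
    using ex_graph_gamma_CR_ge[OF rn rm assms(5)] .
  then obtain x where "x \<in> gamma_CR_values n 0 m" "n - r \<le> x"
    unfolding gamma_CR_values_def by blast
  then have mem: "n - r \<in> gamma_CR_values n 0 m"
    using le by (metis le_antisym)
  have "finite (gamma_CR_values n 0 m)"
    using le by (meson finite_nat_set_iff_bounded_le)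
  then have "Max (gamma_CR_values n 0 m) = n - r"
    using le mem by (intro Max_eqI)
  then have "D n 0 m = n - r"
    using mem by (auto simp: D_def)
  then show ?thesis
    using rn by simp
qed

end
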